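(* There exists a constant $c>0$ such that, for all $n\ge 1$, there is a poset $P$ on $n$ elements satisfying $H(W)\ge H(P)+c\log\log n$ for every weak order $W$ extending $P$.
   Context: Logarithms are base 2. For a poset $Q$ on $n$ elements, $H(Q):=H(G(Q))$ where $G(Q)$ is the comparability graph and, for a graph $G$ on vertex set $V$, $H(G):=\min_{x\in\mathrm{STAB}(G)}-\frac1n\sum_{v\in V}\log x_v$, $\mathrm{STAB}(G)$ being the convex hull of the characteristic vectors of stable sets of $G$. A weak order is a poset whose comparability graph is complete multipartite. A poset $W$ extends $P$ if they have the same ground set and $v\leqslant_P w$ implies $v\leqslant_W w$. *)

theory Defs
  imports "HOL-Analysis.Analysis"
begin

text \<open>
  A simple graph is given by its vertex set \<open>V\<close> and a symmetric, irreflexive adjacency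
  relation \<open>E\<close>; a poset by its ground set and its reflexive order relation.
\<close>

definition stable_sets :: "'a set \<Rightarrow> 'a rel \<Rightarrow> 'a set set" where
  "stable_sets V E = {S. S \<subseteq> V \<and> (\<forall>u\<in>S. \<forall>v\<in>S. (u, v) \<notin> E)}"

text \<open>
  The convex hull of the characteristic vectors of the stable sets. The convex combinations are
  written out because functions \<open>'a \<Rightarrow> real\<close> are no instance of \<open>real_vector\<close>.
\<close>

definition STAB :: "'a set \<Rightarrow> 'a rel \<Rightarrow> ('a \<Rightarrow> real) set" where
  "STAB V E = {x. \<exists>w :: 'a set \<Rightarrow> real.
     (\<forall>S\<in>stable_sets V E. 0 \<le> w S) \<and> (\<Sum>S\<in>stable_sets V E. w S) = 1 \<and>
     x = (\<lambda>v. \<Sum>S\<in>stable_sets V E. w S * indicator S v)}"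

text \<open>
  Points with a zero coordinate have objective value \<open>\<infinity>\<close> and never attain the minimum; they are
  excluded explicitly because \<open>log 2 0 = 0\<close> here. The infimum is a minimum, see
  \<open>graph_entropy_attained\<close> below.
\<close>

definition graph_entropy :: "'a set \<Rightarrow> 'a rel \<Rightarrow> real" where
  "graph_entropy V E =
     (INF x \<in> {x \<in> STAB V E. \<forall>v\<in>V. 0 < x v}. - (1 / real (card V)) * (\<Sum>v\<in>V. log 2 (x v)))"

definition comparability :: "'a rel \<Rightarrow> 'a rel" where
  "comparability P = {(u, v). u \<noteq> v \<and> ((u, v) \<in> P \<or> (v, u) \<in> P)}"

definition poset_entropy :: "'a set \<Rightarrow> 'a rel \<Rightarrow> real" where
  "poset_entropy V P = graph_entropy V (comparability P)"

definition complete_multipartite :: "'a set \<Rightarrow> 'a rel \<Rightarrow> bool" where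
  "complete_multipartite V E \<longleftrightarrow>
     (\<exists>\<P>. partition_on V \<P> \<and>
        (\<forall>u\<in>V. \<forall>v\<in>V. (u, v) \<in> E \<longleftrightarrow> \<not> (\<exists>A\<in>\<P>. u \<in> A \<and> v \<in> A)))"

definition weak_order_on :: "'a set \<Rightarrow> 'a rel \<Rightarrow> bool" where
  "weak_order_on V W \<longleftrightarrow> partial_order_on V W \<and> complete_multipartite V (comparability W)"

definition extends_on :: "'a set \<Rightarrow> 'a rel \<Rightarrow> 'a rel \<Rightarrow> bool" where
  "extends_on V W P \<longleftrightarrow> partial_order_on V W \<and> partial_order_on V P \<and> P \<subseteq> W"

lemma graph_entropy_attained:
  assumes V: "finite V" and E: "irrefl E"
  shows "\<exists>x\<in>STAB V E. (\<forall>v\<in>V. 0 < x v) \<and>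
     graph_entropy V E = - (1 / real (card V)) * (\<Sum>v\<in>V. log 2 (x v)) \<and>
     (\<forall>y\<in>STAB V E. (\<forall>v\<in>V. 0 < y v) \<longrightarrow> graph_entropy V E \<le> - (1 / real (card V)) * (\<Sum>v\<in>V. log 2 (y v)))"
proof -
  define I where "I = stable_sets V E"
  define n where "n = real (card V)"
  define X where "X = (\<lambda>(w :: 'a set \<Rightarrow> real) v. \<Sum>S\<in>I. w S * indicator S v)"
  define h where "h = (\<lambda>x :: 'a \<Rightarrow> real. - (1 / n) * (\<Sum>v\<in>V. log 2 (x v)))"
  define D where "D = {x \<in> STAB V E. \<forall>v\<in>V. 0 < x v}"
  define \<delta> where "\<delta> = (1 / n) powr n"
  have finI: "finite I"
    using V unfolding I_def stable_sets_def by (auto intro: finite_subset[of _ "Pow V"])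
  have STAB_iff: "x \<in> STAB V E \<longleftrightarrow> (\<exists>w. (\<forall>S\<in>I. 0 \<le> w S) \<and> sum w I = 1 \<and> x = X w)" for x
    unfolding STAB_def I_def X_def mem_Collect_eq ..
  have "\<exists>x\<in>D. \<forall>y\<in>D. h x \<le> h y"
  proof (cases "V = {}")
    case True
    have "stable_sets V E = {{}}" using True by (auto simp: stable_sets_def)
    hence "(\<lambda>v. 0) \<in> STAB V E"
      unfolding STAB_def mem_Collect_eq by (intro exI[of _ "\<lambda>_. 1"]) simp
    hence "(\<lambda>v. 0) \<in> D" using True by (auto simp: D_def)
    thus ?thesis using True by (auto simp: h_def)
  next
    case False
    have n1: "n \<ge> 1" using False V by (simp add: n_def Suc_le_eq card_gt_0_iff)
    hence \<delta>0: "\<delta> > 0" by (simp add: \<delta>_def)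
    have X01: "0 \<le> X w v \<and> X w v \<le> 1" if "\<forall>S\<in>I. 0 \<le> w S" "sum w I = 1" for w v
    proof
      show "0 \<le> X w v" unfolding X_def using that by (intro sum_nonneg) auto
      have "X w v \<le> sum w I" unfolding X_def using that
        by (intro sum_mono) (auto simp: indicator_def)
      thus "X w v \<le> 1" using that by simp
    qed
    define B where "B = PiE UNIV (\<lambda>S. if S \<in> I then {0..1::real} else {0})"
    define K where "K = B \<inter> {w. sum w I = 1} \<inter> {w. \<forall>v\<in>V. X w v \<in> {\<delta>..}}"
    have cB: "compact B"
    proof -
      have "compactin (product_topology (\<lambda>_::'a set. euclidean :: real topology) UNIV) B"
        unfolding B_def by (subst compactin_PiE) (auto simp: compactin_euclidean_iff)
      thus ?thesis by (simp add: euclidean_product_topology compactin_euclidean_iff)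
    qed
    have cs: "continuous_on UNIV (\<lambda>w :: 'a set \<Rightarrow> real. w S)" for S
      by (rule continuous_on_product_coordinates)
    have cX: "continuous_on UNIV (\<lambda>w. X w v)" for v
      unfolding X_def by (intro continuous_intros cs)
    have cl1: "closed {w :: 'a set \<Rightarrow> real. sum w I = 1}"
      by (intro closed_Collect_eq continuous_intros cs)
    have "{w. \<forall>v\<in>V. X w v \<in> {\<delta>..}} = (\<Inter>v\<in>V. {w. \<delta> \<le> X w v})" by auto
    moreover have "closed {w. \<delta> \<le> X w v}" for v
      by (intro closed_Collect_le continuous_intros cX)
    ultimately have cl2: "closed {w. \<forall>v\<in>V. X w v \<in> {\<delta>..}}" by auto
    have cK: "compact K" unfolding K_def by (intro compact_Int_closed cB cl1 cl2)
    have Xnz: "X w v \<noteq> 0" if "w \<in> K" "v \<in> V" for w v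
      using that \<delta>0 by (force simp: K_def)
    have ch: "continuous_on K (\<lambda>w. h (X w))"
      unfolding h_def log_def
      by (intro continuous_intros continuous_on_subset[OF cX]) (simp_all add: Xnz)
    have rep: "\<exists>w\<in>B. sum w I = 1 \<and> y = X w" if "y \<in> STAB V E" for y
    proof -
      obtain w where w: "\<forall>S\<in>I. 0 \<le> w S" "sum w I = 1" "y = X w"
        using \<open>y \<in> STAB V E\<close> unfolding STAB_iff by auto
      let ?w = "\<lambda>S. if S \<in> I then w S else 0"
      have "w S \<le> 1" if "S \<in> I" for S
        using member_le_sum[OF that, of w] w finI by auto
      hence "?w \<in> B" using w by (auto simp: B_def)
      moreover have "sum ?w I = 1" using w by simp
      moreover have "y = X ?w" using w by (auto simp: X_def intro!: ext sum.cong)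
      ultimately show ?thesis by blast
    qed
    have mem: "X w \<in> D" if "w \<in> K" for w
    proof -
      have "0 \<le> w S" if "S \<in> I" for S
        using \<open>w \<in> K\<close> that by (auto simp: K_def B_def PiE_iff split: if_splits)
      hence "X w \<in> STAB V E"
        using that unfolding STAB_iff by (intro exI[of _ w]) (auto simp: K_def)
      moreover have "0 < X w v" if "v \<in> V" for v
        using \<open>w \<in> K\<close> that \<delta>0 by (force simp: K_def)
      ultimately show ?thesis by (auto simp: D_def)
    qed
    define w0 where "w0 = (\<lambda>S :: 'a set. if S \<in> (\<lambda>v. {v}) ` V then 1 / n else 0)"
    have sub: "(\<lambda>v. {v}) ` V \<subseteq> I"
      using E by (auto simp: I_def stable_sets_def irrefl_def)
    have sing: "{v} \<in> I" if "v \<in> V" for v using sub that by blast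
    have w0sum: "(\<Sum>S\<in>I. w0 S * f S) = (\<Sum>v\<in>V. f {v}) / n" for f :: "'a set \<Rightarrow> real"
    proof -
      have "(\<Sum>S\<in>I. w0 S * f S) = (\<Sum>S\<in>(\<lambda>v. {v}) ` V. w0 S * f S)"
        by (rule sum.mono_neutral_right[OF finI sub]) (auto simp: w0_def)
      also have "\<dots> = (\<Sum>v\<in>V. w0 {v} * f {v})"
        by (subst sum.reindex) (auto simp: inj_on_def)
      also have "\<dots> = (\<Sum>v\<in>V. f {v} / n)" by (intro sum.cong) (auto simp: w0_def)
      finally show ?thesis by (simp add: sum_divide_distrib)
    qed
    have w0X: "X w0 v = 1 / n" if "v \<in> V" for v
    proof -
      have "(\<Sum>u\<in>V. indicator {u} v :: real) = (\<Sum>u\<in>V. if u = v then 1 else 0)"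
        by (intro sum.cong) (auto simp: indicator_def)
      also have "\<dots> = 1" using V that by simp
      finally show ?thesis unfolding X_def w0sum by simp
    qed
    have \<delta>le: "\<delta> \<le> 1 / n"
    proof -
      have "(1 / n) powr n \<le> (1 / n) powr 1" using n1 by (intro powr_mono') auto
      thus ?thesis using n1 by (simp add: \<delta>_def)
    qed
    have "sum w0 I = 1" using w0sum[of "\<lambda>_. 1"] n1 by (simp add: n_def)
    moreover have "w0 \<in> B" using n1 by (auto simp: B_def w0_def intro: sing)
    ultimately have w0K: "w0 \<in> K" using w0X \<delta>le by (auto simp: K_def)
    have hw0: "h (X w0) = log 2 n"
      using n1 by (simp add: h_def w0X log_divide n_def)
    obtain w where w: "w \<in> K" "\<forall>u\<in>K. h (X w) \<le> h (X u)"
      using continuous_attains_inf[OF cK _ ch] w0K by blast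
    have "h (X w) \<le> h y" if y: "y \<in> D" for y
    proof -
      obtain u where u: "u \<in> B" "sum u I = 1" "y = X u" using rep y by (auto simp: D_def)
      have u0: "\<forall>S\<in>I. 0 \<le> u S" using u(1) by (auto simp: B_def PiE_iff split: if_splits)
      show ?thesis
      proof (cases "u \<in> K")
        case True
        thus ?thesis using w u by blast
      next
        case False
        then obtain v where v: "v \<in> V" "y v < \<delta>" using u by (auto simp: K_def not_le)
        have pos: "0 < y a" if "a \<in> V" for a using y that by (auto simp: D_def)
        have le: "log 2 (y a) \<le> 0" if "a \<in> V" for a
          using pos[OF that] X01[OF u0 u(2), of a] u(3) by simp
        have "(\<Sum>a\<in>V. log 2 (y a)) = log 2 (y v) + (\<Sum>a\<in>V - {v}. log 2 (y a))"
          using V v by (simp add: sum.remove)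
        also have "\<dots> \<le> log 2 (y v)" using sum_nonpos[of "V - {v}" "\<lambda>a. log 2 (y a)"] le by simp
        also have "\<dots> \<le> log 2 \<delta>" using v pos[of v] \<delta>0 by simp
        also have "\<dots> = - (n * log 2 n)" using n1 by (simp add: \<delta>_def log_powr log_divide)
        finally have "log 2 n \<le> h y" using n1 by (simp add: h_def field_simps)
        thus ?thesis using w w0K hw0 by fastforce
      qed
    qed
    thus ?thesis using mem[OF w(1)] by blast
  qed
  then obtain x where x: "x \<in> D" "\<forall>y\<in>D. h x \<le> h y" by blast
  have "graph_entropy V E = Inf (h ` D)"
    by (simp add: graph_entropy_def h_def D_def n_def)
  also have "\<dots> = h x" using x by (intro cInf_eq_minimum) auto
  finally show ?thesis
    using x by (intro bexI[of _ x]) (auto simp: h_def D_def n_def)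
qed

end

theory Submission
  imports Defs
begin

text \<open>
  Take \<open>k + 1\<close> classes of equal size, with \<open>k\<close> about \<open>log n / 2\<close>, and split class \<open>i\<close> into
  disjoint chains of length \<open>2 ^ i\<close>. Then \<open>H(P)\<close> is at most the average class. A weak order
  extending \<open>P\<close> partitions the ground set into antichains. Class \<open>i\<close> contributes at most
  \<open>O(n / ((k + 1) * 2 ^ i))\<close> elements to an antichain, one per chain; since this decays
  geometrically, an antichain as large as the bound for class \<open>j\<close> has average class at most
  \<open>j + O(1)\<close>, and so every antichain partition pays \<open>log (k + 1) - O(1)\<close> extra. For bounded
  \<open>n\<close> any positive gap suffices, and one comparable pair plus isolated elements provides it.
\<close>

section \<open>Upper and lower bounds for graph entropy\<close>

lemma irrefl_comparability: "irrefl (comparability P)"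
  by (simp add: irrefl_def comparability_def)

lemma graph_entropy_le:
  assumes "finite V" "irrefl E" "x \<in> STAB V E" "\<And>v. v \<in> V \<Longrightarrow> 0 < x v"
  shows "graph_entropy V E \<le> - (1 / real (card V)) * (\<Sum>v\<in>V. log 2 (x v))"
  using graph_entropy_attained[OF assms(1,2)] assms(3,4) by blast

lemma finite_stable_sets: "finite V \<Longrightarrow> finite (stable_sets V E)"
  by (rule finite_subset[of _ "Pow V"]) (auto simp: stable_sets_def)

lemma uniform_mixture_in_STAB:
  assumes V: "finite V" and T: "finite T" "T \<noteq> {}"
    and S: "\<And>t. t \<in> T \<Longrightarrow> S t \<in> stable_sets V E"
  shows "(\<lambda>v. real (card {t\<in>T. v \<in> S t}) / real (card T)) \<in> STAB V E"
proof -
  \<comment> \<open>Different \<open>t\<close> may yield the same stable set, so the weight of a set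
    is the fraction of indices that produce it.\<close>
  define w where "w = (\<lambda>X. real (card {t\<in>T. S t = X}) / real (card T))"
  have mix: "(\<Sum>X\<in>stable_sets V E. w X * g X) = (\<Sum>t\<in>T. g (S t)) / real (card T)"
    for g :: "'a set \<Rightarrow> real"
  proof -
    have "(\<Sum>t\<in>T. g (S t)) = (\<Sum>X\<in>stable_sets V E. \<Sum>t\<in>{t\<in>T. S t = X}. g (S t))"
      using S by (intro sum.group[symmetric] T finite_stable_sets V) auto
    also have "\<dots> = (\<Sum>X\<in>stable_sets V E. real (card {t\<in>T. S t = X}) * g X)"
      by (intro sum.cong) auto
    finally show ?thesis by (simp add: w_def sum_divide_distrib)
  qed
  have "(\<Sum>X\<in>stable_sets V E. w X) = 1"
    using mix[of "\<lambda>_. 1"] T by simp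
  moreover have "real (card {t\<in>T. v \<in> S t}) / real (card T)
      = (\<Sum>X\<in>stable_sets V E. w X * indicator X v)" for v
  proof -
    have "(\<Sum>t\<in>T. indicator (S t) v :: real) = (\<Sum>t\<in>T. if v \<in> S t then 1 else 0)"
      by (intro sum.cong) (auto simp: indicator_def)
    also have "\<dots> = real (card {t\<in>T. v \<in> S t})"
      using T by (simp add: sum.If_cases Int_def)
    finally show ?thesis by (simp add: mix)
  qed
  ultimately show ?thesis
    unfolding STAB_def by (intro CollectI exI[of _ w]) (auto simp: w_def)
qed

text \<open>By concavity the logarithm lies below its tangent at \<open>b\<close>. This yields
  Gibbs' inequality below.\<close>

lemma log2_le_tangent:
  assumes "0 < a" "0 < (b::real)"
  shows "log 2 a \<le> log 2 b + (a / b - 1) / ln 2"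
proof -
  have "ln (a / b) \<le> a / b - 1" using assms by (intro ln_le_minus_one) auto
  thus ?thesis using assms by (simp add: log_def ln_div field_simps)
qed

lemma sum_partition_on:
  assumes "finite V" "partition_on V \<P>"
  shows "(\<Sum>v\<in>V. g v) = (\<Sum>A\<in>\<P>. \<Sum>v\<in>A. g v)"
proof -
  have "sum g (\<Union>\<P>) = (\<Sum>A\<in>\<P>. sum g A)"
    using assms finite_elements[OF assms] unfolding partition_on_def disjoint_def
    by (subst sum.Union_disjoint) (auto intro: finite_subset)
  thus ?thesis using assms(2) by (simp add: partition_on_def)
qed

text \<open>Different parts are completely joined, so a stable set meets at most one of them. Hence
  a point of \<open>STAB\<close> distributes total mass at most 1 over the parts, and by Gibbs'
  inequality the best masses are the relative sizes of the parts. The bound is the Shannon entropy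
  of these relative sizes.\<close>

lemma graph_entropy_multipartite_ge:
  assumes V: "finite V" "V \<noteq> {}" and part: "partition_on V \<P>" and irr: "irrefl E"
    and E: "\<And>u v A. u \<in> V \<Longrightarrow> v \<in> V \<Longrightarrow> A \<in> \<P> \<Longrightarrow> u \<in> A \<Longrightarrow> v \<notin> A \<Longrightarrow> (u, v) \<in> E"
  shows "(\<Sum>A\<in>\<P>. real (card A) * log 2 (real (card V) / real (card A))) / real (card V)
    \<le> graph_entropy V E"
proof -
  define n where "n = real (card V)"
  have n: "n > 0" using V by (simp add: n_def card_gt_0_iff)
  have fP: "finite \<P>" using part V(1) by (rule finite_elements[rotated])
  have fA: "finite A" "A \<subseteq> V" "A \<noteq> {}" if "A \<in> \<P>" for A
    using part that V(1) unfolding partition_on_def by (auto intro: finite_subset)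
  have cA: "0 < real (card A)" if "A \<in> \<P>" for A
    using fA[OF that] by (simp add: card_gt_0_iff)
  note split = sum_partition_on[OF V(1) part]
  obtain y where y: "y \<in> STAB V E" and pos: "\<And>v. v \<in> V \<Longrightarrow> 0 < y v"
    and H: "graph_entropy V E = - (1 / n) * (\<Sum>v\<in>V. log 2 (y v))"
    using graph_entropy_attained[OF V(1) irr] unfolding n_def by blast
  let ?I = "stable_sets V E"
  obtain w where w: "\<And>S. S \<in> ?I \<Longrightarrow> 0 \<le> w S" "(\<Sum>S\<in>?I. w S) = 1"
    and yw: "y = (\<lambda>v. \<Sum>S\<in>?I. w S * indicator S v)"
    using y unfolding STAB_def by blast
  \<comment> \<open>The mass of \<open>A\<close> is the total weight of the stable sets that meet
    it. The masses may add up to less than 1, since the empty set is stable too.\<close>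
  define m where "m = (\<lambda>A. \<Sum>S\<in>?I. if S \<inter> A \<noteq> {} then w S else 0)"
  have ym: "y v \<le> m A" if "v \<in> A" for v A
    unfolding yw m_def using that w by (intro sum_mono) (auto simp: indicator_def)
  have "(\<Sum>A\<in>\<P>. m A) = (\<Sum>S\<in>?I. \<Sum>A\<in>\<P>. if S \<inter> A \<noteq> {} then w S else 0)"
    unfolding m_def by (rule sum.swap)
  also have "\<dots> \<le> (\<Sum>S\<in>?I. w S)"
  proof (rule sum_mono)
    fix S assume S: "S \<in> ?I"
    have uniq: "A = B" if "A \<in> \<P>" "B \<in> \<P>" "S \<inter> A \<noteq> {}" "S \<inter> B \<noteq> {}" for A B
    proof (rule ccontr)
      assume "A \<noteq> B"
      hence "A \<inter> B = {}" using part that unfolding partition_on_def disjoint_def by blast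
      moreover obtain u v where uv: "u \<in> S" "u \<in> A" "v \<in> S" "v \<in> B"
        using \<open>S \<inter> A \<noteq> {}\<close> \<open>S \<inter> B \<noteq> {}\<close> by blast
      ultimately have "v \<notin> A" by blast
      hence "(u, v) \<in> E" using E[of u v A] uv fA(2) that by blast
      thus False using S uv by (auto simp: stable_sets_def)
    qed
    have "card {A\<in>\<P>. S \<inter> A \<noteq> {}} \<le> 1"
      using uniq fP by (auto simp: card_le_Suc0_iff_eq)
    hence "real (card {A\<in>\<P>. S \<inter> A \<noteq> {}}) * w S \<le> 1 * w S"
      using w(1)[OF S] by (intro mult_right_mono) auto
    thus "(\<Sum>A\<in>\<P>. if S \<inter> A \<noteq> {} then w S else 0) \<le> w S"
      using fP by (simp add: sum.If_cases Int_def)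
  qed
  finally have m1: "(\<Sum>A\<in>\<P>. m A) \<le> 1" using w(2) by simp
  have "(\<Sum>v\<in>A. log 2 (y v)) \<le> - (real (card A) * log 2 (n / real (card A)))
      + (n * m A - real (card A)) / ln 2" if A: "A \<in> \<P>" for A
  proof -
    note c = cA[OF A]
    have mpos: "0 < m A"
      using fA[OF A] pos ym by (metis all_not_in_conv less_le_trans subsetD)
    have "(\<Sum>v\<in>A. log 2 (y v)) \<le> (\<Sum>v\<in>A. log 2 (m A))"
      using fA[OF A] pos ym mpos by (intro sum_mono) auto
    also have "\<dots> = real (card A) * log 2 (m A)" by simp
    \<comment> \<open>The tangent is taken at the optimal mass \<open>card A / n\<close>. Summed
      over all parts, the linear corrections become a positive multiple of
      \<open>sum m \<P> - 1\<close>, which is at most 0.\<close>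
    also have "\<dots> \<le> real (card A) * (log 2 (real (card A) / n) + (m A / (real (card A) / n) - 1) / ln 2)"
      using c n mpos by (intro mult_left_mono log2_le_tangent) auto
    also have "\<dots> = - (real (card A) * log 2 (n / real (card A))) + (n * m A - real (card A)) / ln 2"
      using c n by (simp add: log_divide field_simps)
    finally show ?thesis .
  qed
  hence "(\<Sum>v\<in>V. log 2 (y v)) \<le> (\<Sum>A\<in>\<P>. - (real (card A) * log 2 (n / real (card A)))
      + (n * m A - real (card A)) / ln 2)"
    unfolding split by (rule sum_mono)
  also have "\<dots> = - (\<Sum>A\<in>\<P>. real (card A) * log 2 (n / real (card A)))
      + (n * (\<Sum>A\<in>\<P>. m A) - (\<Sum>A\<in>\<P>. real (card A))) / ln 2"
    by (simp add: sum.distrib sum_negf sum_divide_distrib sum_distrib_left sum_subtractf diff_divide_distrib)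
  also have "(\<Sum>A\<in>\<P>. real (card A)) = n" using split[of "\<lambda>_. 1 :: real"] by (simp add: n_def)
  also have "(n * (\<Sum>A\<in>\<P>. m A) - n) / ln 2 \<le> 0"
    using m1 n by (simp add: divide_nonpos_pos)
  finally have "(\<Sum>v\<in>V. log 2 (y v)) \<le> - (\<Sum>A\<in>\<P>. real (card A) * log 2 (n / real (card A)))"
    by simp
  hence "(\<Sum>A\<in>\<P>. real (card A) * log 2 (n / real (card A))) / n \<le> - (\<Sum>v\<in>V. log 2 (y v)) / n"
    using n by (intro divide_right_mono) auto
  thus ?thesis by (simp add: H n_def)
qed

section \<open>Disjoint unions of chains and their weak extensions\<close>

text \<open>The value of \<open>f\<close> names the chain of an element, so a subset of
  \<open>V\<close> is an antichain exactly when \<open>f\<close> is injective on it.\<close>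

definition chain_union :: "nat set \<Rightarrow> (nat \<Rightarrow> 'b) \<Rightarrow> nat rel" where
  "chain_union V f = {(u, v). u \<in> V \<and> v \<in> V \<and> f u = f v \<and> u \<le> v}"

lemma partial_order_chain_union: "partial_order_on V (chain_union V f)"
  unfolding partial_order_on_def preorder_on_def chain_union_def
  by (auto simp: refl_on_def trans_def antisym_def)

text \<open>
  Cyclic shifts of the positions give \<open>2 ^ k\<close> antichains that meet a chain of
  length \<open>2 ^ i\<close> uniformly, so \<open>x v = 1 / 2 ^ i v\<close> is feasible.
\<close>

lemma poset_entropy_chain_union_le:
  fixes pos i :: "nat \<Rightarrow> nat"
  assumes V: "finite V"
    and inj: "\<And>u v. u \<in> V \<Longrightarrow> v \<in> V \<Longrightarrow> f u = f v \<Longrightarrow> pos u = pos v \<Longrightarrow> u = v"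
    and i: "\<And>u v. u \<in> V \<Longrightarrow> v \<in> V \<Longrightarrow> f u = f v \<Longrightarrow> i u = i v"
    and pos: "\<And>v. v \<in> V \<Longrightarrow> pos v < 2 ^ i v"
    and k: "\<And>v. v \<in> V \<Longrightarrow> i v \<le> k"
  shows "poset_entropy V (chain_union V f) \<le> (\<Sum>v\<in>V. real (i v)) / real (card V)"
proof -
  \<comment> \<open>A chain may lack some positions; \<open>S t\<close> takes from each chain the
    element at position \<open>t mod 2 ^ i\<close>, if there is one.\<close>
  define S where "S = (\<lambda>t::nat. {v\<in>V. t mod 2 ^ i v = pos v})"
  define T where "T = {..<(2::nat) ^ k}"
  have "finite T" "0 \<in> T" by (auto simp: T_def)
  define x where "x = (\<lambda>v. real (card {t\<in>T. v \<in> S t}) / real (card T))"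
  have "u = v" if "u \<in> S t" "v \<in> S t" "f u = f v" for t u v
    using that inj[of u v] i[of u v] by (simp add: S_def)
  moreover have "u \<noteq> v \<and> f u = f v" if "(u, v) \<in> comparability (chain_union V f)" for u v
    using that by (auto simp: comparability_def chain_union_def)
  ultimately have "(u, v) \<notin> comparability (chain_union V f)" if "u \<in> S t" "v \<in> S t" for t u v
    using that by blast
  moreover have "S t \<subseteq> V" for t by (auto simp: S_def)
  ultimately have "S t \<in> stable_sets V (comparability (chain_union V f))" for t
    by (simp add: stable_sets_def)
  hence st: "x \<in> STAB V (comparability (chain_union V f))"
    unfolding x_def using \<open>0 \<in> T\<close> \<open>finite T\<close> by (intro uniform_mixture_in_STAB V) auto
  have x: "x v = 1 / 2 ^ i v" if v: "v \<in> V" for v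
  proof -
    \<comment> \<open>As \<open>2 ^ i v\<close> divides \<open>2 ^ k\<close>, each residue is hit by
      the same number of \<open>t < 2 ^ k\<close>.\<close>
    have "{t\<in>T. v \<in> S t} = (\<lambda>q. pos v + q * 2 ^ i v) ` {..<2 ^ (k - i v)}"
    proof (intro equalityI subsetI)
      fix t assume "t \<in> {t\<in>T. v \<in> S t}"
      hence t: "t < 2 ^ k" "t mod 2 ^ i v = pos v" by (auto simp: T_def S_def)
      have "(2::nat) ^ k = 2 ^ (k - i v) * 2 ^ i v"
        using k[OF v] by (simp flip: power_add)
      hence "t div 2 ^ i v < 2 ^ (k - i v)" using t by (simp add: less_mult_imp_div_less)
      moreover have "t = pos v + t div 2 ^ i v * 2 ^ i v" using t mod_div_mult_eq[of t "2 ^ i v"] by simp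
      ultimately show "t \<in> (\<lambda>q. pos v + q * 2 ^ i v) ` {..<2 ^ (k - i v)}" by blast
    next
      fix t assume "t \<in> (\<lambda>q. pos v + q * 2 ^ i v) ` {..<2 ^ (k - i v)}"
      then obtain q where q: "q < 2 ^ (k - i v)" "t = pos v + q * 2 ^ i v" by blast
      have "t < (q + 1) * 2 ^ i v" using q pos[OF v] by simp
      also have "\<dots> \<le> 2 ^ (k - i v) * 2 ^ i v" using q by (intro mult_right_mono) auto
      also have "\<dots> = 2 ^ k" using k[OF v] by (simp flip: power_add)
      finally show "t \<in> {t\<in>T. v \<in> S t}" using q pos[OF v] v by (simp add: T_def S_def)
    qed
    moreover have "inj_on (\<lambda>q. pos v + q * 2 ^ i v) {..<2 ^ (k - i v)}"
      by (auto simp: inj_on_def)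
    ultimately have "card {t\<in>T. v \<in> S t} = 2 ^ (k - i v)" by (simp add: card_image)
    moreover have "card T = 2 ^ k" by (simp add: T_def)
    ultimately have "x v = 2 ^ (k - i v) / 2 ^ k" by (simp add: x_def)
    thus ?thesis using k[OF v] by (simp add: power_diff)
  qed
  have "poset_entropy V (chain_union V f) \<le> - (1 / real (card V)) * (\<Sum>v\<in>V. log 2 (x v))"
    unfolding poset_entropy_def using st x by (intro graph_entropy_le V irrefl_comparability) auto
  also have "(\<Sum>v\<in>V. log 2 (x v)) = - (\<Sum>v\<in>V. real (i v))"
    by (simp add: x log_divide log_nat_power flip: sum_negf)
  finally show ?thesis by simp
qed

text \<open>The parts of a weak order are antichains of every order that it extends, so they contain
  at most one element of each chain. The multipartite bound then applies to them.\<close>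

lemma weak_order_extension_entropy_ge:
  assumes V: "finite V" "V \<noteq> {}" and W: "weak_order_on V W" "extends_on V W (chain_union V f)"
  obtains \<P> where "partition_on V \<P>" "\<And>A. A \<in> \<P> \<Longrightarrow> inj_on f A"
    "(\<Sum>A\<in>\<P>. real (card A) * log 2 (real (card V) / real (card A))) / real (card V)
      \<le> poset_entropy V W"
proof -
  obtain \<P> where part: "partition_on V \<P>"
    and E: "\<And>u v. u \<in> V \<Longrightarrow> v \<in> V \<Longrightarrow>
      (u, v) \<in> comparability W \<longleftrightarrow> \<not> (\<exists>A\<in>\<P>. u \<in> A \<and> v \<in> A)"
    using W(1) unfolding weak_order_on_def complete_multipartite_def by (elim conjE exE) metis
  have "inj_on f A" if "A \<in> \<P>" for A
  proof (rule inj_onI, rule ccontr)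
    fix u v assume uv: "u \<in> A" "v \<in> A" "f u = f v" "u \<noteq> v"
    have V': "u \<in> V" "v \<in> V" using part that uv unfolding partition_on_def by auto
    hence "(u, v) \<in> W \<or> (v, u) \<in> W"
      using W(2) uv nat_le_linear[of u v] unfolding extends_on_def chain_union_def by auto
    hence "(u, v) \<in> comparability W" using uv by (simp add: comparability_def)
    thus False using E[OF V'] that uv by blast
  qed
  moreover have "(u, v) \<in> comparability W"
    if "u \<in> V" "v \<in> V" "A \<in> \<P>" "u \<in> A" "v \<notin> A" for u v A
  proof -
    have "u \<notin> B" if "B \<in> \<P>" "v \<in> B" for B
      using part that \<open>A \<in> \<P>\<close> \<open>u \<in> A\<close> \<open>v \<notin> A\<close> unfolding partition_on_def disjoint_def by blast
    thus ?thesis using E that by blast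
  qed
  hence "(\<Sum>A\<in>\<P>. real (card A) * log 2 (real (card V) / real (card A))) / real (card V)
      \<le> poset_entropy V W"
    unfolding poset_entropy_def
    by (intro graph_entropy_multipartite_ge V part irrefl_comparability)
  ultimately show thesis using part by (intro that)
qed


text \<open>The upper bound for the chains and the lower bound for \<open>W\<close> both split into
  sums over the parts of \<open>W\<close>. It therefore suffices to compare them on a single
  antichain \<open>A\<close>, whatever the partition is.\<close>

lemma entropy_gap_chain_union:
  fixes pos i :: "nat \<Rightarrow> nat"
  assumes V: "finite V" "V \<noteq> {}"
    and chains: "\<And>u v. u \<in> V \<Longrightarrow> v \<in> V \<Longrightarrow> f u = f v \<Longrightarrow> pos u = pos v \<Longrightarrow> u = v"
      "\<And>u v. u \<in> V \<Longrightarrow> v \<in> V \<Longrightarrow> f u = f v \<Longrightarrow> i u = i v"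
      "\<And>v. v \<in> V \<Longrightarrow> pos v < 2 ^ i v"
      "\<And>v. v \<in> V \<Longrightarrow> i v \<le> k"
    and gap: "\<And>A. A \<subseteq> V \<Longrightarrow> A \<noteq> {} \<Longrightarrow> inj_on f A \<Longrightarrow>
      real (card A) * \<delta> + (\<Sum>v\<in>A. real (i v))
        \<le> real (card A) * log 2 (real (card V) / real (card A))"
    and W: "weak_order_on V W" "extends_on V W (chain_union V f)"
  shows "poset_entropy V (chain_union V f) + \<delta> \<le> poset_entropy V W"
proof -
  define n where "n = real (card V)"
  have n: "n > 0" using V by (simp add: n_def card_gt_0_iff)
  obtain \<P> where part: "partition_on V \<P>" and inj: "\<And>A. A \<in> \<P> \<Longrightarrow> inj_on f A"
    and H: "(\<Sum>A\<in>\<P>. real (card A) * log 2 (n / real (card A))) / n \<le> poset_entropy V W"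
    using weak_order_extension_entropy_ge[OF V W] unfolding n_def by blast
  have A: "A \<subseteq> V" "A \<noteq> {}" if "A \<in> \<P>" for A
    using part that unfolding partition_on_def by auto
  have "n * \<delta> + (\<Sum>v\<in>V. real (i v)) = (\<Sum>v\<in>V. \<delta> + real (i v))"
    by (simp add: n_def sum.distrib)
  also have "\<dots> = (\<Sum>A\<in>\<P>. \<Sum>v\<in>A. \<delta> + real (i v))"
    by (rule sum_partition_on[OF V(1) part])
  also have "\<dots> \<le> (\<Sum>A\<in>\<P>. real (card A) * log 2 (n / real (card A)))"
    using gap[OF A inj] by (intro sum_mono) (simp add: sum.distrib n_def)
  finally have "(n * \<delta> + (\<Sum>v\<in>V. real (i v))) / n
      \<le> (\<Sum>A\<in>\<P>. real (card A) * log 2 (n / real (card A))) / n"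
    using n by (intro divide_right_mono) auto
  hence "\<delta> + (\<Sum>v\<in>V. real (i v)) / n
      \<le> (\<Sum>A\<in>\<P>. real (card A) * log 2 (n / real (card A))) / n"
    using n by (simp add: add_divide_distrib)
  moreover have "poset_entropy V (chain_union V f) \<le> (\<Sum>v\<in>V. real (i v)) / n"
    unfolding n_def by (rule poset_entropy_chain_union_le[OF V(1) chains])
  ultimately show ?thesis using H by linarith
qed

section \<open>A positive gap for bounded n\<close>

text \<open>This is the binomial expansion cut off after the quadratic term. Bernoulli's inequality
  would give only \<open>(1 + 1 / a) ^ a \<ge> 2\<close>, which leaves no slack in the next
  lemma.\<close>

lemma power_one_plus_ge_quadratic:
  fixes x :: real
  assumes "0 \<le> x"
  shows "1 + real m * x + real m * (real m - 1) / 2 * x\<^sup>2 \<le> (1 + x) ^ m"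
proof (induction m)
  case (Suc m)
  have "1 + real (Suc m) * x + real (Suc m) * (real (Suc m) - 1) / 2 * x\<^sup>2
      \<le> (1 + x) * (1 + real m * x + real m * (real m - 1) / 2 * x\<^sup>2)"
  proof -
    \<comment> \<open>The product on the right exceeds the left side by exactly this cubic
      term.\<close>
    have "0 \<le> real m * (real m - 1)" by (cases m) auto
    hence "0 \<le> real m * (real m - 1) / 2 * x\<^sup>2 * x" using assms by simp
    thus ?thesis by (simp add: algebra_simps power2_eq_square) (simp add: field_simps)
  qed
  also have "\<dots> \<le> (1 + x) * (1 + x) ^ m" using Suc assms by (intro mult_left_mono) auto
  finally show ?case by simp
qed simp

text \<open>Since \<open>n \<ge> a + 1\<close>, the power \<open>(n / a) ^ a\<close> is at least
  \<open>(1 + 1 / a) ^ a\<close>, which is at least 9/4 for \<open>a \<ge> 2\<close>. For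
  \<open>a = 1\<close> it equals \<open>n \<ge> 3\<close>. Any bound above 1 would give a gap; 9/8
  is convenient.\<close>

lemma card_mult_log_ge:
  assumes "1 \<le> a" "a < n" "3 \<le> n"
  shows "9 / 8 \<le> real a * log 2 (real n / real a)"
proof -
  have "(9 / 4 :: real) \<le> (real n / real a) ^ a"
  proof (cases "a = 1")
    case True
    thus ?thesis using assms by simp
  next
    case False
    hence a: "2 \<le> real a" using assms by simp
    have "9 / 4 \<le> 1 + real a * (1 / real a) + real a * (real a - 1) / 2 * (1 / real a)\<^sup>2"
      using a by (simp add: field_simps power2_eq_square)
    also have "\<dots> \<le> (1 + 1 / real a) ^ a"
      by (rule power_one_plus_ge_quadratic) simp
    also have "1 + 1 / real a = real (Suc a) / real a" using a by (simp add: field_simps)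
    also have "\<dots> ^ a \<le> (real n / real a) ^ a"
      using assms by (intro power_mono divide_right_mono) auto
    finally show ?thesis .
  qed
  \<comment> \<open>Comparing eighth powers: 2^9 = 512, while (9/4)^8 exceeds 656.\<close>
  moreover have "2 powr (9 / 8) \<le> (9 / 4 :: real)"
  proof (rule power_le_imp_le_base)
    have "(2 powr (9 / 8 :: real)) ^ Suc 7 = 2 powr 9"
      by (simp add: powr_realpow[symmetric] powr_powr del: power_Suc)
    also have "\<dots> \<le> (9 / 4) ^ Suc 7" by (simp add: power_divide)
    finally show "(2 powr (9 / 8 :: real)) ^ Suc 7 \<le> (9 / 4) ^ Suc 7" .
  qed simp
  ultimately have "log 2 (2 powr (9 / 8)) \<le> log 2 ((real n / real a) ^ a)"
    by (intro log_mono) auto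
  thus ?thesis using assms by (simp add: log_nat_power)
qed

text \<open>This serves n = 1 and n = 2, where the required gap is 0: with singleton chains,
  \<open>log 2 (n / card A) \<ge> 0\<close> is all that is asked.\<close>

lemma antichain_gap:
  assumes "1 \<le> n"
  shows "\<exists>P. partial_order_on {..<n} P \<and> (\<forall>W. weak_order_on {..<n} W \<and> extends_on {..<n} W P
    \<longrightarrow> poset_entropy {..<n::nat} P \<le> poset_entropy {..<n} W)"
proof (intro exI conjI allI impI)
  show "partial_order_on {..<n} (chain_union {..<n} id)" by (rule partial_order_chain_union)
  fix W assume W: "weak_order_on {..<n} W \<and> extends_on {..<n} W (chain_union {..<n} id)"
  have ne: "{..<n} \<noteq> {}" using assms by (auto simp: lessThan_empty_iff)
  have "poset_entropy {..<n} (chain_union {..<n} id) + 0 \<le> poset_entropy {..<n} W"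
  proof (rule entropy_gap_chain_union[of _ id "\<lambda>_. 0" "\<lambda>_. 0" 0])
    fix A assume A: "A \<subseteq> {..<n}" "A \<noteq> {}"
    have "finite A" using A by (rule_tac finite_subset) auto
    hence "0 < card A" using A by (simp add: card_gt_0_iff)
    moreover have "card A \<le> n" using card_mono[OF _ A(1)] by simp
    ultimately show "real (card A) * 0 + (\<Sum>v\<in>A. real 0)
        \<le> real (card A) * log 2 (real (card {..<n}) / real (card A))" by simp
  qed (use W ne in auto)
  thus "poset_entropy {..<n} (chain_union {..<n} id) \<le> poset_entropy {..<n} W" by simp
qed

text \<open>The only nontrivial chain is 0 < 1. An antichain misses one of the two, so it is a
  proper subset of the ground set and its classes sum to at most 1, against the 9/8 of
  \<open>card_mult_log_ge\<close>.\<close>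

lemma one_comparable_pair_gap:
  assumes "3 \<le> n"
  shows "\<exists>P. partial_order_on {..<n} P \<and> (\<forall>W. weak_order_on {..<n} W \<and> extends_on {..<n} W P
    \<longrightarrow> poset_entropy {..<n} P + 1 / (8 * real n) \<le> poset_entropy {..<n} W)"
proof (intro exI conjI allI impI)
  define f where "f = (\<lambda>v::nat. if v \<le> 1 then 0 else v)"
  define i where "i = (\<lambda>v::nat. if v \<le> 1 then 1 else 0 :: nat)"
  define pos where "pos = (\<lambda>v::nat. if v \<le> 1 then v else 0)"
  show "partial_order_on {..<n} (chain_union {..<n} f)" by (rule partial_order_chain_union)
  have ne: "{..<n} \<noteq> {}" using assms by (auto simp: lessThan_empty_iff)
  fix W assume W: "weak_order_on {..<n} W \<and> extends_on {..<n} W (chain_union {..<n} f)"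
  show "poset_entropy {..<n} (chain_union {..<n} f) + 1 / (8 * real n) \<le> poset_entropy {..<n} W"
  proof (rule entropy_gap_chain_union[of _ f pos i 1])
    fix A assume A: "A \<subseteq> {..<n}" "A \<noteq> {}" "inj_on f A"
    have fin: "finite A" using A by (rule_tac finite_subset) auto
    have not2: "\<not> {0, 1} \<subseteq> A" using inj_onD[OF A(3), of 0 1] by (auto simp: f_def)
    moreover have "{0, 1} \<subseteq> {..<n}" using assms by auto
    ultimately have "A \<subset> {..<n}" using A(1) by auto
    hence a: "card A < n" using psubset_card_mono[of "{..<n}" A] by simp
    have "(\<Sum>v\<in>A. real (i v)) = real (card (A \<inter> {..1}))"
      using fin by (simp add: i_def sum.If_cases if_distrib[of real] Int_def)
    also have "card (A \<inter> {..1}) \<le> 1"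
      using A(3) fin by (auto simp: card_le_Suc0_iff_eq inj_on_def f_def)
    finally have "(\<Sum>v\<in>A. real (i v)) \<le> 1" by simp
    \<comment> \<open>The slack 9/8 - 1 is shared by fewer than \<open>n\<close> elements.\<close>
    moreover have "real (card A) * (1 / (8 * real n)) \<le> 1 / 8" using a by (simp add: field_simps)
    moreover have "9 / 8 \<le> real (card A) * log 2 (real n / real (card A))"
      using a assms A fin by (intro card_mult_log_ge) (auto simp: Suc_le_eq card_gt_0_iff)
    ultimately show "real (card A) * (1 / (8 * real n)) + (\<Sum>v\<in>A. real (i v))
        \<le> real (card A) * log 2 (real (card {..<n}) / real (card A))" by simp
  qed (use W ne in \<open>auto simp: f_def i_def pos_def split: if_splits\<close>)
qed

section \<open>A growing gap from chains of geometrically growing length\<close>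

text \<open>Truncated subtraction kills the terms up to \<open>M\<close>; shifting the rest by
  \<open>M\<close> leaves a part of the series of d / 2^d, whose sum is 2.\<close>

lemma sum_diff_div_power2_le:
  fixes K M :: nat
  shows "(\<Sum>j<K. real (j - M) / 2 ^ j) \<le> 2 / 2 ^ M"
proof (cases "M \<le> K")
  case True
  then obtain d where d: "K = M + d" using le_Suc_ex by blast
  have "(\<Sum>j<M + d. real (j - M) / 2 ^ j) = (2 - 2 * (real d + 1) / 2 ^ d) / 2 ^ M"
  proof (induction d)
    case (Suc d)
    have "(\<Sum>j<M + Suc d. real (j - M) / 2 ^ j)
        = (2 - 2 * (real d + 1) / 2 ^ d) / 2 ^ M + real d / 2 ^ (M + d)"
      using Suc by simp
    also have "\<dots> = (2 - 2 * (real (Suc d) + 1) / 2 ^ Suc d) / 2 ^ M"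
      by (simp add: power_add field_simps)
    finally show ?case .
  qed simp
  also have "\<dots> \<le> 2 / 2 ^ M" by (intro divide_right_mono) auto
  finally show ?thesis by (simp add: d)
qed simp

text \<open>
  Only classes beyond \<open>M\<close>, about \<open>log 2 (z / card A)\<close>, are too small to fill \<open>A\<close>; their sizes decay
  geometrically, so the average excess over \<open>M\<close> is bounded.
\<close>

lemma sum_class_le:
  fixes i :: "'a \<Rightarrow> nat" and z :: real
  assumes A: "finite A" "A \<noteq> {}" and z: "z > 0" and K: "\<And>v. v \<in> A \<Longrightarrow> i v < K"
    and cls: "\<And>j. j < K \<Longrightarrow> real (card {v\<in>A. i v = j}) \<le> 2 * z / 2 ^ j"
  shows "(\<Sum>v\<in>A. real (i v)) \<le> real (card A) * (log 2 (z / real (card A)) + 6)"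
proof -
  define s where "s = real (card A)"
  have s: "s > 0" using A by (simp add: s_def card_gt_0_iff)
  have group: "(\<Sum>v\<in>A. g (i v)) \<le> 2 * z * (\<Sum>j<K. g j / 2 ^ j)"
    if g: "\<And>j. 0 \<le> g j" for g :: "nat \<Rightarrow> real"
  proof -
    have "(\<Sum>v\<in>A. g (i v)) = (\<Sum>j<K. \<Sum>v\<in>{v\<in>A. i v = j}. g (i v))"
      using K A by (intro sum.group[symmetric]) auto
    also have "\<dots> = (\<Sum>j<K. real (card {v\<in>A. i v = j}) * g j)" by (intro sum.cong) auto
    also have "\<dots> \<le> (\<Sum>j<K. 2 * z / 2 ^ j * g j)"
      using cls g by (intro sum_mono mult_right_mono) auto
    finally show ?thesis by (simp add: sum_distrib_left)
  qed
  \<comment> \<open>The class bounds limit all of \<open>A\<close> to \<open>4 * z\<close> elements,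
    so the logarithm below is at least -2.\<close>
  have "s \<le> 2 * z * (\<Sum>j<K. 1 / 2 ^ j)" using group[of "\<lambda>_. 1"] by (simp add: s_def)
  also have "(\<Sum>j<K. 1 / 2 ^ j :: real) = 2 - 2 / 2 ^ K"
    by (induction K) (auto simp: field_simps)
  also have "2 * z * (2 - 2 / 2 ^ K) \<le> 2 * z * 2" using z by (intro mult_left_mono) auto
  finally have "log 2 (1 / 4) \<le> log 2 (z / s)" using s z by (intro log_mono) (auto simp: field_simps)
  moreover have "log 2 (1 / 4 :: real) = - 2"
    using log_nat_power[of 2 2 2] by (simp add: log_divide)
  ultimately have lg: "- 2 \<le> log 2 (z / s)" by simp
  \<comment> \<open>\<open>nat\<close> turns a negative ceiling into 0; thanks to the bound -2,
    \<open>M\<close> still exceeds the logarithm by at most 2. The excess over \<open>M\<close> will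
    cost another 4, whence the constant 6.\<close>
  define M where "M = nat \<lceil>log 2 (z / s)\<rceil>"
  have M: "log 2 (z / s) \<le> real M" "real M \<le> log 2 (z / s) + 2"
    using lg unfolding M_def by linarith+
  have "z / s = 2 powr log 2 (z / s)" using z s by simp
  also have "\<dots> \<le> 2 powr real M" using M by simp
  finally have zM: "z / 2 ^ M \<le> s" using s by (simp add: powr_realpow field_simps)
  have "(\<Sum>v\<in>A. real (i v)) \<le> (\<Sum>v\<in>A. real M + real (i v - M))" by (intro sum_mono) linarith
  also have "\<dots> = s * real M + (\<Sum>v\<in>A. real (i v - M))" by (simp add: sum.distrib s_def)
  also have "(\<Sum>v\<in>A. real (i v - M)) \<le> 2 * z * (\<Sum>j<K. real (j - M) / 2 ^ j)"
    by (rule group) simp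
  also have "\<dots> \<le> 2 * z * (2 / 2 ^ M)"
    using z by (intro mult_left_mono sum_diff_div_power2_le) auto
  also have "\<dots> \<le> 4 * s" using zM by simp
  also have "s * real M + 4 * s \<le> s * (log 2 (z / s) + 2) + 4 * s"
    using M s by (intro add_right_mono mult_left_mono) auto
  finally show ?thesis by (simp add: s_def algebra_simps)
qed

text \<open>Residues mod \<open>K\<close> form the classes, and the quotients in class
  \<open>i\<close> are cut into blocks of length \<open>2 ^ i\<close>, the last one possibly
  incomplete. The gain is \<open>log 2 K\<close> because \<open>sum_class_le\<close> compares
  \<open>card A\<close> with the average class size \<open>z = n / K\<close> instead of
  \<open>n\<close>.\<close>

lemma geometric_chains_gap:
  assumes n: "2 ^ k * Suc k \<le> n"
  shows "\<exists>P. partial_order_on {..<n} P \<and> (\<forall>W. weak_order_on {..<n} W \<and> extends_on {..<n} W P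
    \<longrightarrow> poset_entropy {..<n} P + (log 2 (real (Suc k)) - 6) \<le> poset_entropy {..<n} W)"
proof (intro exI conjI allI impI)
  define K where "K = Suc k"
  have K: "K > 0" by (simp add: K_def)
  have "0 < (2::nat) ^ k * Suc k" by simp
  hence n0: "n > 0" using n by linarith
  define i where "i = (\<lambda>v. v mod K)"
  define f where "f = (\<lambda>v. (i v, v div K div 2 ^ i v))"
  define pos where "pos = (\<lambda>v. v div K mod 2 ^ i v)"
  define z where "z = real n / real K"
  have z: "z > 0" using n0 K by (simp add: z_def)
  have z2: "2 ^ k \<le> z"
  proof -
    have "real (2 ^ k * K) \<le> real n" using n unfolding K_def by (rule of_nat_mono)
    thus ?thesis using K by (simp add: z_def field_simps)
  qed
  show "partial_order_on {..<n} (chain_union {..<n} f)" by (rule partial_order_chain_union)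
  have ne: "{..<n} \<noteq> {}" using n0 by (auto simp: lessThan_empty_iff)
  fix W assume W: "weak_order_on {..<n} W \<and> extends_on {..<n} W (chain_union {..<n} f)"
  show "poset_entropy {..<n} (chain_union {..<n} f) + (log 2 (real (Suc k)) - 6)
      \<le> poset_entropy {..<n} W"
  proof (rule entropy_gap_chain_union[of _ f pos i k])
    fix u v assume "f u = f v" "pos u = pos v"
    hence "u mod K = v mod K" "u div K div 2 ^ i v = v div K div 2 ^ i v"
      "u div K mod 2 ^ i v = v div K mod 2 ^ i v"
      by (auto simp: f_def i_def pos_def)
    thus "u = v" by (metis div_mod_decomp)
  next
    fix A assume A: "A \<subseteq> {..<n}" "A \<noteq> {}" "inj_on f A"
    have fin: "finite A" using A by (rule_tac finite_subset) auto
    have s: "0 < real (card A)" using A fin by (simp add: card_gt_0_iff)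
    have "real (card {v\<in>A. i v = j}) \<le> 2 * z / 2 ^ j" if j: "j < K" for j
    proof -
      define q where "q = (\<lambda>v. v div K div 2 ^ j)"
      have "inj_on q {v\<in>A. i v = j}"
        using A(3) by (auto simp: inj_on_def f_def q_def)
      moreover have "q ` {v\<in>A. i v = j} \<subseteq> {..nat \<lfloor>z / 2 ^ j\<rfloor>}"
      proof (intro image_subsetI)
        fix v assume "v \<in> {v\<in>A. i v = j}"
        hence v: "v \<le> n" using A by auto
        have "real (q v) \<le> real (v div K) / 2 ^ j"
          unfolding q_def using of_nat_div_le_of_nat[of "v div K" "2 ^ j"] by simp
        also have "\<dots> \<le> real v / real K / 2 ^ j"
          by (intro divide_right_mono of_nat_div_le_of_nat) auto
        also have "\<dots> \<le> z / 2 ^ j" unfolding z_def using v by (intro divide_right_mono) auto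
        finally show "q v \<in> {..nat \<lfloor>z / 2 ^ j\<rfloor>}" by (simp add: le_nat_floor)
      qed
      ultimately have "card {v\<in>A. i v = j} \<le> card {..nat \<lfloor>z / 2 ^ j\<rfloor>}"
        by (intro card_inj_on_le) auto
      hence "real (card {v\<in>A. i v = j}) \<le> real (nat \<lfloor>z / 2 ^ j\<rfloor>) + 1" by simp
      also have "\<dots> \<le> z / 2 ^ j + 1" using z by (simp add: of_nat_nat)
      \<comment> \<open>The hypothesis on \<open>n\<close> makes \<open>z\<close> at least the
        longest chain length, so the extra 1 from rounding and counting from 0 only doubles the
        bound.\<close>
      also have "1 \<le> z / 2 ^ j"
      proof -
        have "(2::real) ^ j \<le> 2 ^ k" using j by (intro power_increasing) (auto simp: K_def)
        also note z2
        finally show ?thesis by simp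
      qed
      finally show ?thesis by simp
    qed
    hence "(\<Sum>v\<in>A. real (i v)) \<le> real (card A) * (log 2 (z / real (card A)) + 6)"
      using K by (intro sum_class_le[where K = K] fin A z) (auto simp: i_def)
    also have "log 2 (z / real (card A)) = log 2 (real n / real (card A)) - log 2 (real K)"
      using s n0 K by (simp add: z_def log_divide log_mult)
    finally show "real (card A) * (log 2 (real (Suc k)) - 6) + (\<Sum>v\<in>A. real (i v))
        \<le> real (card A) * log 2 (real (card {..<n}) / real (card A))"
      by (simp add: K_def algebra_simps)
  qed (use W ne K in \<open>auto simp: f_def i_def pos_def K_def less_Suc_eq_le[symmetric]\<close>)
qed

section \<open>Choice of parameters and of the constant\<close>

text \<open>With \<open>k\<close> the floor of half of \<open>log 2 n\<close>, the construction
  fits, as 2^k (k + 1) \<le> 4^k \<le> n. Using \<open>Suc k \<ge> log 2 n / 2\<close> costs 1 more,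
  so 6 becomes 7.\<close>

lemma log_log_gap:
  assumes "1 \<le> n"
  shows "\<exists>P. partial_order_on {..<n} P \<and> (\<forall>W. weak_order_on {..<n} W \<and> extends_on {..<n} W P
    \<longrightarrow> poset_entropy {..<n} P + (log 2 (log 2 (real n)) - 7) \<le> poset_entropy {..<n} W)"
proof -
  define k where "k = nat \<lfloor>log 2 (real n) / 2\<rfloor>"
  have lg: "0 \<le> log 2 (real n)" using assms by simp
  hence k: "real k \<le> log 2 (real n) / 2" "log 2 (real n) / 2 \<le> real (Suc k)"
    unfolding k_def by linarith+
  have "real (2 ^ k * Suc k) \<le> real (2 ^ k * 2 ^ k)"
    using less_exp[of k] by (intro of_nat_mono mult_left_mono) (auto simp: Suc_le_eq)
  also have "\<dots> = 2 powr (2 * real k)" by (simp add: powr_realpow[symmetric] flip: powr_add)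
  also have "\<dots> \<le> 2 powr log 2 (real n)" using k by simp
  also have "\<dots> = real n" using assms by simp
  finally have "2 ^ k * Suc k \<le> n" by (simp only: of_nat_le_iff)
  then obtain P where P: "partial_order_on {..<n} P" "\<And>W. weak_order_on {..<n} W \<Longrightarrow>
      extends_on {..<n} W P \<Longrightarrow>
      poset_entropy {..<n} P + (log 2 (real (Suc k)) - 6) \<le> poset_entropy {..<n} W"
    using geometric_chains_gap by blast
  have "log 2 (log 2 (real n)) - 1 \<le> log 2 (real (Suc k))"
  \<comment> \<open>For \<open>n = 1\<close> the iterated logarithm is 0 by the convention
    \<open>log 2 0 = 0\<close>.\<close>
  proof (cases "log 2 (real n) = 0")
    case True
    have "0 \<le> log 2 (real (Suc k))" by simp
    moreover have "log 2 (log 2 (real n)) = 0" unfolding True by (simp add: log_def)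
    ultimately show ?thesis by linarith
  next
    case False
    hence "log 2 (log 2 (real n) / 2) \<le> log 2 (real (Suc k))"
      using k lg by (intro log_mono) auto
    thus ?thesis using False lg by (simp add: log_divide)
  qed
  thus ?thesis using P by (intro exI[of _ P]) force
qed

theorem theorem5:
  shows "\<exists>c::real. c > 0 \<and> (\<forall>n::nat. n \<ge> 1 \<longrightarrow>
    (\<exists>(V :: nat set) P. finite V \<and> card V = n \<and> partial_order_on V P \<and>
      (\<forall>W. weak_order_on V W \<and> extends_on V W P \<longrightarrow>
        poset_entropy V W \<ge> poset_entropy V P + c * log 2 (log 2 (real n)))))"
proof -
  \<comment> \<open>\<open>b\<close> is where the iterated logarithm reaches 8. Below it,
    \<open>c * 8 = 1 / (8 * b)\<close> is less than the gap \<open>1 / (8 * n)\<close> of one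
    comparable pair.\<close>
  define b where "b = (2::real) powr (2 powr 8)"
  have b: "b > 0" by (simp add: b_def)
  have b1: "b \<ge> 1" unfolding b_def by (intro ge_one_powr_ge_zero) auto
  define c where "c = 1 / (64 * b)"
  have c: "c > 0" "c \<le> 1 / 8" using b b1 by (auto simp: c_def field_simps)
  have main: "\<exists>P. partial_order_on {..<n} P \<and> (\<forall>W. weak_order_on {..<n} W \<and> extends_on {..<n} W P
      \<longrightarrow> poset_entropy {..<n} P + c * log 2 (log 2 (real n)) \<le> poset_entropy {..<n} W)"
    if n: "n \<ge> 1" for n
  proof -
    let ?L = "log 2 (log 2 (real n))"
    consider "?L \<ge> 8" | "?L < 8" "n \<ge> 3" | "n \<le> 2" by linarith
    thus ?thesis
    proof cases
      case 1
      \<comment> \<open>From 8 on, \<open>?L - 7 \<ge> ?L / 8\<close>, with equality at 8.\<close>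
      have "c * ?L \<le> 1 / 8 * ?L" using c 1 by (intro mult_right_mono) auto
      hence "c * ?L \<le> ?L - 7" using 1 by linarith
      thus ?thesis using log_log_gap[OF n] by force
    next
      case 2
      have "log 2 (real n) > 0" using 2 by simp
      hence "log 2 (real n) < 2 powr 8" using 2 by (simp add: log_less_iff)
      hence "real n < b" using 2 by (simp add: log_less_iff b_def)
      have "c * ?L \<le> c * 8" using c 2 by (intro mult_left_mono) auto
      also have "\<dots> = 1 / (8 * b)" by (simp add: c_def)
      also have "\<dots> \<le> 1 / (8 * real n)" using \<open>real n < b\<close> 2 by (intro divide_left_mono) auto
      finally show ?thesis using one_comparable_pair_gap[OF 2(2)] by force
    next
      case 3
      hence "n = 1 \<or> n = 2" using n by auto
      \<comment> \<open>For \<open>n = 2\<close> this is the true value; for \<open>n = 1\<close> it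
        is the convention for \<open>log 2 0\<close>.\<close>
      hence L: "?L = 0" by (auto simp: log_def)
      show ?thesis using antichain_gap[OF n] by (simp add: L)
    qed
  qed
  show ?thesis
  proof (intro exI[of _ c] conjI allI impI c)
    fix n :: nat assume "n \<ge> 1"
    then obtain P where "partial_order_on {..<n} P" "\<And>W. weak_order_on {..<n} W \<Longrightarrow>
        extends_on {..<n} W P \<Longrightarrow>
        poset_entropy {..<n} P + c * log 2 (log 2 (real n)) \<le> poset_entropy {..<n} W"
      using main by blast
    thus "\<exists>(V :: nat set) P. finite V \<and> card V = n \<and> partial_order_on V P \<and>
      (\<forall>W. weak_order_on V W \<and> extends_on V W P \<longrightarrow>
        poset_entropy V W \<ge> poset_entropy V P + c * log 2 (log 2 (real n)))"
      by (intro exI[of _ "{..<n}"] exI[of _ P]) auto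
  qed
qed

end
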